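(* Let $X_1$ be the conjugacy class of the matrix $J=\begin{pmatrix}0&1\\1&0\end{pmatrix}$ in $GL(2,\mathbb{F}_3)$, and let $X_2$ be the conjugacy class of $3$-cycles in the alternating group $A_5$. Then the direct product $\operatorname{Conj}(X_1)\times\operatorname{Conj}(X_2)$ of their conjugation quandles is a connected noninvolutory quandle equipped with multiple good involutions, i.e. $\lvert\operatorname{Good}(\operatorname{Conj}(X_1)\times\operatorname{Conj}(X_2))\rvert\geq 2$.
   Context: A quandle is a set $Q$ with a binary operation $\ast$ such that $x\ast x=x$; each map $s_y\colon x\mapsto x\ast y$ is invertible; and $(x\ast y)\ast z=(x\ast z)\ast(y\ast z)$. Write $x\ast^{-1}y:=s_y^{-1}(x)$. A quandle is involutory if $\ast=\ast^{-1}$, and noninvolutory otherwise. It is connected if the group of bijections of $Q$ generated by $\{s_y\mid y\in Q\}$ acts transitively on $Q$. A good involution on $(Q,\ast)$ is a map $\rho\colon Q\to Q$ with $\rho\circ\rho=\mathrm{id}_Q$, $\rho(x\ast y)=\rho(x)\ast y$ and $x\ast\rho(y)=x\ast^{-1}y$ for all $x,y\in Q$; $\operatorname{Good}(Q,\ast)$ is the set of good involutions. For a conjugacy class $X$ of a group $G$, the conjugation quandle $\operatorname{Conj}(X)$ is $X$ with $g\ast h:=h^{-1}gh$. The direct product of two quandles is the Cartesian product with the componentwise operation. *)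

theory Defs
  imports "HOL-Analysis.Analysis" "HOL-Algebra.Algebra"
begin

section \<open>Quandles\<close>

record 'a quandle_struct = "'a partial_object" +
  qop :: "'a \<Rightarrow> 'a \<Rightarrow> 'a" (infixl \<open>\<triangleleft>\<index>\<close> 70)

locale quandle =
  fixes Q (structure)
  assumes closed: "\<lbrakk>x \<in> carrier Q; y \<in> carrier Q\<rbrakk> \<Longrightarrow> x \<triangleleft> y \<in> carrier Q"
    and idem: "x \<in> carrier Q \<Longrightarrow> x \<triangleleft> x = x"
    and bij: "y \<in> carrier Q \<Longrightarrow> bij_betw (\<lambda>x. x \<triangleleft> y) (carrier Q) (carrier Q)"
    and distrib: "\<lbrakk>x \<in> carrier Q; y \<in> carrier Q; z \<in> carrier Q\<rbrakk>
      \<Longrightarrow> (x \<triangleleft> y) \<triangleleft> z = (x \<triangleleft> z) \<triangleleft> (y \<triangleleft> z)"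

definition qop_inv :: "('a, 'm) quandle_struct_scheme \<Rightarrow> 'a \<Rightarrow> 'a \<Rightarrow> 'a"
    (infixl \<open>\<triangleleft>\<^sup>-\<index>\<close> 70)
  where "qop_inv Q x y = inv_into (carrier Q) (\<lambda>z. z \<triangleleft>\<^bsub>Q\<^esub> y) x"

definition involutory :: "('a, 'm) quandle_struct_scheme \<Rightarrow> bool"
  where "involutory Q \<longleftrightarrow>
    (\<forall>x\<in>carrier Q. \<forall>y\<in>carrier Q. x \<triangleleft>\<^bsub>Q\<^esub> y = x \<triangleleft>\<^sup>-\<^bsub>Q\<^esub> y)"

definition inner_group :: "('a, 'm) quandle_struct_scheme \<Rightarrow> ('a \<Rightarrow> 'a) monoid"
  where "inner_group Q = subgroup_generated (BijGroup (carrier Q))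
    {\<lambda>x\<in>carrier Q. x \<triangleleft>\<^bsub>Q\<^esub> y | y. y \<in> carrier Q}"

definition connected_quandle :: "('a, 'm) quandle_struct_scheme \<Rightarrow> bool"
  where "connected_quandle Q \<longleftrightarrow> transitive_action (inner_group Q) (carrier Q) (\<lambda>g. g)"

text \<open>Good involutions are maps from the carrier to itself, so they are taken
  to be extensional; otherwise one map would be counted several times.\<close>

definition Good :: "('a, 'm) quandle_struct_scheme \<Rightarrow> ('a \<Rightarrow> 'a) set"
  where "Good Q = {\<rho> \<in> carrier Q \<rightarrow>\<^sub>E carrier Q.
    (\<forall>x\<in>carrier Q. \<rho> (\<rho> x) = x) \<and>
    (\<forall>x\<in>carrier Q. \<forall>y\<in>carrier Q. \<rho> (x \<triangleleft>\<^bsub>Q\<^esub> y) = \<rho> x \<triangleleft>\<^bsub>Q\<^esub> y) \<and>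
    (\<forall>x\<in>carrier Q. \<forall>y\<in>carrier Q. x \<triangleleft>\<^bsub>Q\<^esub> \<rho> y = x \<triangleleft>\<^sup>-\<^bsub>Q\<^esub> y)}"

definition quandle_prod ::
    "('a, 'm) quandle_struct_scheme \<Rightarrow> ('b, 'n) quandle_struct_scheme \<Rightarrow> ('a \<times> 'b) quandle_struct"
  where "quandle_prod Q R = \<lparr>carrier = carrier Q \<times> carrier R,
    qop = (\<lambda>(x, x') (y, y'). (x \<triangleleft>\<^bsub>Q\<^esub> y, x' \<triangleleft>\<^bsub>R\<^esub> y'))\<rparr>"

definition conjugacy_class :: "('a, 'm) monoid_scheme \<Rightarrow> 'a \<Rightarrow> 'a set"
  where "conjugacy_class G a =
    {inv\<^bsub>G\<^esub> g \<otimes>\<^bsub>G\<^esub> a \<otimes>\<^bsub>G\<^esub> g | g. g \<in> carrier G}"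

definition Conj :: "('a, 'm) monoid_scheme \<Rightarrow> 'a set \<Rightarrow> 'a quandle_struct"
  where "Conj G C = \<lparr>carrier = C,
    qop = (\<lambda>g h. inv\<^bsub>G\<^esub> h \<otimes>\<^bsub>G\<^esub> g \<otimes>\<^bsub>G\<^esub> h)\<rparr>"


section \<open>The two groups\<close>

text \<open>The numeral type \<open>3\<close> is the ring of integers modulo 3, i.e. the field
  with three elements; it is only registered as a commutative ring.\<close>

lemma F3_inverse: "x \<noteq> 0 \<Longrightarrow> x * x = 1" for x :: 3
  using exhaust_3[of x] by auto

definition GL2_F3 :: "(3^2^2) monoid"
  where "GL2_F3 = \<lparr>carrier = {A. invertible A}, mult = (**), one = mat 1\<rparr>"

lemma group_GL2_F3: "group GL2_F3"
proof (rule groupI)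
  fix A assume "A \<in> carrier GL2_F3"
  then obtain B where "A ** B = mat 1" "B ** A = mat 1"
    by (auto simp: GL2_F3_def invertible_def)
  then show "\<exists>B\<in>carrier GL2_F3. B \<otimes>\<^bsub>GL2_F3\<^esub> A = \<one>\<^bsub>GL2_F3\<^esub>"
    by (auto simp: GL2_F3_def invertible_def)
next
  fix A B assume "A \<in> carrier GL2_F3" "B \<in> carrier GL2_F3"
  then obtain A' B' where "A ** A' = mat 1" "A' ** A = mat 1" "B ** B' = mat 1" "B' ** B = mat 1"
    by (auto simp: GL2_F3_def invertible_def)
  then have "(A ** B) ** (B' ** A') = mat 1 \<and> (B' ** A') ** (A ** B) = mat 1"
    by (metis matrix_mul_assoc matrix_mul_rid)
  then show "A \<otimes>\<^bsub>GL2_F3\<^esub> B \<in> carrier GL2_F3"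
    by (auto simp: GL2_F3_def invertible_def)
qed (auto simp: GL2_F3_def matrix_mul_assoc invertible_def intro: exI[of _ "mat 1"])

definition J :: "3^2^2"
  where "J = vector [vector [0, 1], vector [1, 0]]"

lemma J_in_GL2_F3: "J \<in> carrier GL2_F3"
proof -
  have "J ** J = mat 1"
    by (simp add: J_def matrix_matrix_mult_def mat_def vec_eq_iff forall_2 sum_2 vector_2)
  then show ?thesis by (auto simp: GL2_F3_def invertible_def)
qed

lemma even_perm_mapping_three_points:
  assumes cs: "distinct cs" "length cs = 3" "set cs \<subseteq> {1..5::nat}"
    and ds: "distinct ds" "length ds = 3" "set ds \<subseteq> {1..5::nat}"
  obtains p where "p permutes {1..5}" "evenperm p" "map p cs = ds"
proof -
  let ?S = "{1..5::nat}"
  have ext: "\<exists>es. distinct (xs @ es) \<and> length es = 2 \<and> set (xs @ es) = ?S"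
    if "distinct xs" "length xs = 3" "set xs \<subseteq> ?S" for xs
  proof -
    obtain es where es: "set es = ?S - set xs" "distinct es"
      using finite_distinct_list[of "?S - set xs"] by auto
    have "length es = card (?S - set xs)" using es by (metis distinct_card)
    also have "\<dots> = 2" using that by (simp add: card_Diff_subset distinct_card)
    finally show ?thesis using es that by auto
  qed
  obtain es where es: "distinct (cs @ es)" "length es = 2" "set (cs @ es) = ?S" using ext[OF cs] by blast
  obtain fs where fs: "distinct (ds @ fs)" "length fs = 2" "set (ds @ fs) = ?S" using ext[OF ds] by blast
  define f where "f = (!) (ds @ fs) \<circ> inv_into {..<5} ((!) (cs @ es))"
  define p where "p = (\<lambda>x. if x \<in> ?S then f x else x)"
  have bc: "bij_betw ((!) (cs @ es)) {..<5} ?S"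
    by (rule bij_betw_nth) (use es cs in auto)
  have bd: "bij_betw ((!) (ds @ fs)) {..<5} ?S"
    by (rule bij_betw_nth) (use fs ds in auto)
  have "bij_betw f ?S ?S"
    unfolding f_def by (rule bij_betw_trans[OF bij_betw_inv_into[OF bc] bd])
  then have "bij_betw p ?S ?S"
    by (subst bij_betw_cong[of _ _ f]) (auto simp: p_def)
  then have p: "p permutes ?S"
    by (rule bij_imp_permutes) (auto simp: p_def)
  have nth: "p (cs ! i) = ds ! i" if "i < 3" for i
  proof -
    have i: "i \<in> {..<5}" using that by simp
    have "cs ! i = (cs @ es) ! i" using that cs by (simp add: nth_append)
    moreover have "ds ! i = (ds @ fs) ! i" using that ds by (simp add: nth_append)
    moreover have "cs ! i \<in> ?S" using that cs by (metis nth_mem subsetD)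
    moreover have "inv_into {..<5} ((!) (cs @ es)) ((cs @ es) ! i) = i"
      using inv_into_f_f[OF bij_betw_imp_inj_on[OF bc] i] .
    ultimately show ?thesis by (simp add: p_def f_def)
  qed
  have mp: "map p cs = ds" by (rule nth_equalityI) (use cs ds nth in auto)
  obtain u v where uv: "fs = [u, v]" using fs(2)
    by (metis length_0_conv length_Suc_conv numeral_2_eq_2)
  let ?q = "Transposition.transpose u v \<circ> p"
  have "u \<noteq> v" "u \<in> ?S" "v \<in> ?S" "u \<notin> set ds" "v \<notin> set ds" using fs uv by auto
  then have q: "?q permutes ?S" "map ?q cs = ds"
    using p permutes_compose[OF p permutes_swap_id[of u ?S v]] mp
    by (auto simp: map_map[symmetric] simp del: map_map intro!: map_idI transpose_apply_other)
  have "evenperm ?q \<longleftrightarrow> evenperm (Transposition.transpose u v) = evenperm p"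
    using p by (intro evenperm_comp permutation_swap_id) (auto simp: permutation_permutes)
  then have "evenperm p \<or> evenperm ?q" using \<open>u \<noteq> v\<close> by (auto simp: evenperm_swap)
  then show thesis using that p mp q by blast
qed

text \<open>The 3-cycles form a single conjugacy class of the alternating group.\<close>

lemma three_cycles_conjugacy_class:
  assumes "c \<in> three_cycles 5"
  shows "conjugacy_class (alt_group 5) c = three_cycles 5"
proof (intro equalityI subsetI)
  obtain cs where cs: "c = cycle_of_list cs" "cycle cs" "length cs = 3" "set cs \<subseteq> {1..5}"
    using assms by auto
  {
    fix d assume "d \<in> conjugacy_class (alt_group 5) c"
    then obtain g where g: "g \<in> carrier (alt_group 5)" "d = inv' g \<circ> c \<circ> g"
      by (auto simp: conjugacy_class_def alt_group_inv_equality alt_group_mult)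
    then have gp: "g permutes {1..5}" by (simp add: alt_group_carrier)
    have g': "inv' g permutes {1..5}" using gp by (rule permutes_inv)
    have "d = cycle_of_list (map (inv' g) cs)"
      using conjugation_of_cycle[OF cs(2) permutes_bij[OF g']] g(2) cs(1) permutes_inv_inv[OF gp]
      by simp
    moreover have "distinct (map (inv' g) cs)"
      using cs(2) permutes_inj_on[OF g'] by (simp add: distinct_map)
    moreover have "set (map (inv' g) cs) \<subseteq> {1..5}"
      using cs(4) permutes_image[OF g'] by auto
    ultimately show "d \<in> three_cycles 5" using cs(3)
      by (intro CollectI exI[of _ "map (inv' g) cs"]) simp
  next
    fix d assume "d \<in> three_cycles 5"
    then obtain ds where ds: "d = cycle_of_list ds" "cycle ds" "length ds = 3" "set ds \<subseteq> {1..5}"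
      by auto
    obtain p where p: "p permutes {1..5}" "evenperm p" "map p cs = ds"
      using even_perm_mapping_three_points[of cs ds] cs ds by auto
    let ?g = "inv' p"
    have pc: "p \<in> carrier (alt_group 5)" using p by (simp add: alt_group_carrier)
    have g: "?g \<in> carrier (alt_group 5)" by (rule alt_group_inv_closed[OF pc])
    have "d = inv' ?g \<circ> c \<circ> ?g"
      using conjugation_of_cycle[OF cs(2) permutes_bij[OF p(1)]] p(3) ds(1) cs(1) permutes_inv_inv[OF p(1)]
      by simp
    then show "d \<in> conjugacy_class (alt_group 5) c"
      using g alt_group_inv_equality[OF g]
        by (auto simp: conjugacy_class_def alt_group_mult intro!: exI[of _ ?g])
  }
qed

end

theory Submission
  imports Defs
begin

text \<open>Both factors are connected for the same reason: a conjugacy class that generates its group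
  is a connected conjugation quandle (\<open>connected_quandle_Conj\<close>). The 3-cycles generate the
  alternating group. The class of \<open>J\<close> consists of all matrices of trace 0 and determinant -1
  (\<open>conjugacy_class_J\<close>), and every matrix of determinant 1 is a product of two of these
  (\<open>GL2_F3_generated_by_class_J\<close>). Products of connected quandles are connected, because
  idempotence allows one coordinate to be moved while the other is fixed
  (\<open>connected_quandle_prod\<close>).

  In a group, \<open>x \<mapsto> z \<otimes> inv x\<close> is a good involution of a conjugation-closed set that it
  preserves, for each central \<open>z\<close> (\<open>central_inverse_Good\<close>), and a pair of good involutions of
  the factors is a good involution of the product. The class of \<open>J\<close> consists of elements of
  order 2 and is closed under negation, so \<open>z = 1\<close> and \<open>z = -1\<close> give the identity and
  \<open>x \<mapsto> -x\<close> there. Pairing each with inversion of 3-cycles gives two different good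
  involutions of the product. They are counted in a finite set, since both classes are finite.

  The product is not involutory, because two 3-cycles that share one point do not commute.\<close>

section \<open>Quandles, connectedness and products\<close>

lemma (in quandle) qop_inv_eqI:
  assumes "z \<in> carrier Q" "y \<in> carrier Q" "z \<triangleleft> y = x"
  shows "x \<triangleleft>\<^sup>-\<^bsub>Q\<^esub> y = z"
  using inv_into_f_f[OF bij_betw_imp_inj_on[OF bij[OF assms(2)]] assms(1)] assms(3)
  by (simp add: qop_inv_def)

lemma (in quandle) qop_qop_inv:
  assumes "x \<in> carrier Q" "y \<in> carrier Q"
  shows "(x \<triangleleft>\<^sup>-\<^bsub>Q\<^esub> y) \<triangleleft> y = x"
  using bij_betw_inv_into_right[OF bij[OF assms(2)] assms(1)] by (simp add: qop_inv_def)

lemma (in quandle) eq_qop_inv_iff: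
  assumes "x \<in> carrier Q" "y \<in> carrier Q" "z \<in> carrier Q"
  shows "z = x \<triangleleft>\<^sup>-\<^bsub>Q\<^esub> y \<longleftrightarrow> z \<triangleleft> y = x"
  using qop_inv_eqI[OF assms(3,2)] qop_qop_inv[OF assms(1,2)] by metis

text \<open>Since translations are invertible, conditions on the inverse operation can be
  traded for equations in the operation alone; all later computations use these two forms.\<close>

lemma (in quandle) involutory_iff:
  "involutory Q \<longleftrightarrow> (\<forall>x\<in>carrier Q. \<forall>y\<in>carrier Q. (x \<triangleleft> y) \<triangleleft> y = x)"
  by (simp add: involutory_def eq_qop_inv_iff closed cong: ball_cong_simp)

lemma (in quandle) Good_iff:
  "\<rho> \<in> Good Q \<longleftrightarrow> \<rho> \<in> carrier Q \<rightarrow>\<^sub>E carrier Q \<and>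
    (\<forall>x\<in>carrier Q. \<rho> (\<rho> x) = x) \<and>
    (\<forall>x\<in>carrier Q. \<forall>y\<in>carrier Q. \<rho> (x \<triangleleft> y) = \<rho> x \<triangleleft> y) \<and>
    (\<forall>x\<in>carrier Q. \<forall>y\<in>carrier Q. (x \<triangleleft> \<rho> y) \<triangleleft> y = x)"
proof (cases "\<rho> \<in> carrier Q \<rightarrow>\<^sub>E carrier Q")
  case True
  then have "x \<triangleleft> \<rho> y = x \<triangleleft>\<^sup>-\<^bsub>Q\<^esub> y \<longleftrightarrow> (x \<triangleleft> \<rho> y) \<triangleleft> y = x"
    if "x \<in> carrier Q" "y \<in> carrier Q" for x y
    using that by (intro eq_qop_inv_iff) (auto intro: closed)
  then show ?thesis by (auto simp: Good_def)
qed (simp add: Good_def)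

definition translate :: "('a, 'm) quandle_struct_scheme \<Rightarrow> 'a \<Rightarrow> 'a \<Rightarrow> bool"
  where "translate Q x z \<longleftrightarrow> x \<in> carrier Q \<and> (\<exists>y\<in>carrier Q. z = x \<triangleleft>\<^bsub>Q\<^esub> y)"

lemma (in quandle) translation_in_Bij:
  assumes "y \<in> carrier Q"
  shows "(\<lambda>x\<in>carrier Q. x \<triangleleft> y) \<in> Bij (carrier Q)"
  using bij[OF assms] by (simp add: Bij_def cong: bij_betw_cong)

lemma (in quandle) inner_group_action: "group_action (inner_group Q) (carrier Q) (\<lambda>g. g)"
proof -
  interpret B: group "BijGroup (carrier Q)" by (rule group_BijGroup)
  have "(\<lambda>g. g) \<in> hom (BijGroup (carrier Q)) (BijGroup (carrier Q))"
    by (simp add: hom_def)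
  then have "(\<lambda>g. g) \<in> hom (inner_group Q) (BijGroup (carrier Q))"
    unfolding inner_group_def by (rule B.hom_from_subgroup_generated)
  then show ?thesis
    by (intro group_action.intro group_hom.intro group_hom_axioms.intro)
      (simp_all add: inner_group_def group_BijGroup)
qed

text \<open>An inverse translation carries \<open>x\<close> to a point whose translate is \<open>x\<close>, so it moves
  backwards along a translation step. This is why the symmetric closure is taken.\<close>

lemma (in quandle) inner_group_orbit_equivclp:
  assumes "g \<in> carrier (inner_group Q)" "x \<in> carrier Q"
  shows "equivclp (translate Q) x (g x)"
proof -
  let ?B = "BijGroup (carrier Q)"
  interpret B: group ?B by (rule group_BijGroup)
  let ?T = "{\<lambda>x\<in>carrier Q. x \<triangleleft> y | y. y \<in> carrier Q}"
  have T: "carrier ?B \<inter> ?T = ?T" using translation_in_Bij by (auto simp: BijGroup_def)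
  have step: "equivclp (translate Q) x (h x)" if "h \<in> ?T" "x \<in> carrier Q" for h x
    using that by (auto simp: translate_def intro!: r_into_equivclp)
  have "g \<in> generate ?B ?T"
    using assms(1) T by (simp add: inner_group_def carrier_subgroup_generated)
  then have "\<forall>x\<in>carrier Q. equivclp (translate Q) x (g x)"
  proof induction
    case one
    then show ?case by (simp add: BijGroup_def)
  next
    case (incl h)
    then show ?case using step by blast
  next
    case (inv h)
    then have h: "h \<in> Bij (carrier Q)" using translation_in_Bij by auto
    have eq: "(inv\<^bsub>?B\<^esub> h) x = inv_into (carrier Q) h x" if "x \<in> carrier Q" for x
      using inv_BijGroup[OF h] that by simp
    show ?case
    proof
      fix x assume x: "x \<in> carrier Q"
      have "inv_into (carrier Q) h x \<in> carrier Q" by (rule Bij_inv_into_mem[OF h x])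
      moreover have "h (inv_into (carrier Q) h x) = x"
        using h x by (auto simp: Bij_def intro: bij_betw_inv_into_right)
      ultimately show "equivclp (translate Q) x ((inv\<^bsub>?B\<^esub> h) x)"
        using step[OF inv] eq[OF x] by (metis equivclp_sym)
    qed
  next
    case (eng h k)
    have "generate ?B ?T \<subseteq> Bij (carrier Q)"
      using B.generate_incl[of ?T] T by (auto simp: BijGroup_def)
    then have "h \<in> Bij (carrier Q)" "k \<in> Bij (carrier Q)" using eng.hyps by auto
    moreover from this have "k x \<in> carrier Q" if "x \<in> carrier Q" for x
      using that Bij_imp_funcset by blast
    ultimately show ?case
      using eng.IH by (auto simp: BijGroup_def compose_def intro: equivclp_trans)
  qed
  then show ?thesis using assms(2) by blast
qed

text \<open>Replacing the inner group by chains of translations makes connectedness a statement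
  about points, which can be proved by induction along a chain.\<close>

lemma (in quandle) connected_quandle_iff:
  "connected_quandle Q \<longleftrightarrow>
    (\<forall>x\<in>carrier Q. \<forall>z\<in>carrier Q. equivclp (translate Q) x z)"
proof
  assume "connected_quandle Q"
  then interpret transitive_action "inner_group Q" "carrier Q" "\<lambda>g. g"
    by (simp add: connected_quandle_def)
  show "\<forall>x\<in>carrier Q. \<forall>z\<in>carrier Q. equivclp (translate Q) x z"
    using unique_orbit inner_group_orbit_equivclp by blast
next
  assume reach: "\<forall>x\<in>carrier Q. \<forall>z\<in>carrier Q. equivclp (translate Q) x z"
  interpret group_action "inner_group Q" "carrier Q" "\<lambda>g. g" by (rule inner_group_action)
  interpret B: group "BijGroup (carrier Q)" by (rule group_BijGroup)
  let ?O = "orbit (inner_group Q) (\<lambda>g. g)"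
  have reach_step: "z \<in> ?O x" if "translate Q x z" for x z
  proof -
    obtain y where y: "x \<in> carrier Q" "y \<in> carrier Q" "z = x \<triangleleft> y"
      using \<open>translate Q x z\<close> by (auto simp: translate_def)
    have "(\<lambda>x\<in>carrier Q. x \<triangleleft> y) \<in> carrier (inner_group Q)"
      using translation_in_Bij[OF y(2)] y(2) unfolding inner_group_def carrier_subgroup_generated
      by (intro generate.incl) (auto simp: BijGroup_def)
    then show ?thesis using y unfolding orbit_def
      by (intro CollectI exI[of _ "\<lambda>x\<in>carrier Q. x \<triangleleft> y"]) simp
  qed
  have "z \<in> carrier Q \<and> z \<in> ?O x" if "equivclp (translate Q) x z" "x \<in> carrier Q" for x z
    using that
  proof (induction rule: equivclp_induct)
    case base
    then show ?case using orbit_refl by blast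
  next
    case (step y z)
    then have yz: "translate Q y z \<or> translate Q z y" and y: "y \<in> carrier Q" by auto
    then have z: "z \<in> carrier Q" using closed by (auto simp: translate_def)
    then have "z \<in> ?O y" using yz y reach_step orbit_sym by blast
    then show ?case using step y z orbit_trans by blast
  qed
  then have "\<exists>g\<in>carrier (inner_group Q). g x = z" if "x \<in> carrier Q" "z \<in> carrier Q" for x z
    using reach that unfolding orbit_def by blast
  then show "connected_quandle Q"
    unfolding connected_quandle_def
    by (intro transitive_action.intro transitive_action_axioms.intro inner_group_action) auto
qed

lemma carrier_quandle_prod [simp]: "carrier (quandle_prod Q R) = carrier Q \<times> carrier R"
  by (simp add: quandle_prod_def)

lemma qop_quandle_prod [simp]:
  "(x, x') \<triangleleft>\<^bsub>quandle_prod Q R\<^esub> (y, y') = (x \<triangleleft>\<^bsub>Q\<^esub> y, x' \<triangleleft>\<^bsub>R\<^esub> y')"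
  by (simp add: quandle_prod_def)

lemma quandle_quandle_prod:
  assumes "quandle Q" "quandle R"
  shows "quandle (quandle_prod Q R)"
proof -
  interpret Q: quandle Q by fact
  interpret R: quandle R by fact
  show ?thesis
  proof
    fix y assume "y \<in> carrier (quandle_prod Q R)"
    then obtain u v where y: "y = (u, v)" "u \<in> carrier Q" "v \<in> carrier R" by auto
    have "(\<lambda>x. x \<triangleleft>\<^bsub>quandle_prod Q R\<^esub> y) = map_prod (\<lambda>x. x \<triangleleft>\<^bsub>Q\<^esub> u) (\<lambda>x. x \<triangleleft>\<^bsub>R\<^esub> v)"
      by (auto simp: y)
    then show "bij_betw (\<lambda>x. x \<triangleleft>\<^bsub>quandle_prod Q R\<^esub> y)
        (carrier (quandle_prod Q R)) (carrier (quandle_prod Q R))"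
      using bij_betw_map_prod[OF Q.bij[OF y(2)] R.bij[OF y(3)]] by simp
  qed (auto simp: Q.closed R.closed Q.idem R.idem Q.distrib[symmetric] R.distrib[symmetric])
qed

text \<open>The two factors cannot in general be translated independently by arbitrary elements,
  because a translation of the product acts on both coordinates at once. Idempotence removes
  the obstacle: the second coordinate of the translating element may be chosen equal to the
  coordinate that should stay put. Hence one can first move the left coordinate along its
  chain and then the right one.\<close>

lemma connected_quandle_prod:
  assumes "quandle Q" "quandle R" "connected_quandle Q" "connected_quandle R"
  shows "connected_quandle (quandle_prod Q R)"
proof -
  interpret Q: quandle Q by fact
  interpret R: quandle R by fact
  interpret P: quandle "quandle_prod Q R" using assms(1,2) by (rule quandle_quandle_prod)
  let ?E = "equivclp (translate (quandle_prod Q R))"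
  have left_step: "translate (quandle_prod Q R) (y, w) (z, w)"
    if "translate Q y z" "w \<in> carrier R" for y z w
  proof -
    obtain u where u: "y \<in> carrier Q" "u \<in> carrier Q" "z = y \<triangleleft>\<^bsub>Q\<^esub> u"
      using \<open>translate Q y z\<close> by (auto simp: translate_def)
    \<comment> \<open>By idempotence, translating by \<open>(u, w)\<close> fixes the second coordinate \<open>w\<close>.\<close>
    then show ?thesis unfolding translate_def
      using \<open>w \<in> carrier R\<close> by (intro conjI bexI[of _ "(u, w)"]) (auto simp: R.idem)
  qed
  have right_step: "translate (quandle_prod Q R) (w, y) (w, z)"
    if "translate R y z" "w \<in> carrier Q" for y z w
  proof -
    obtain u where u: "y \<in> carrier R" "u \<in> carrier R" "z = y \<triangleleft>\<^bsub>R\<^esub> u"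
      using \<open>translate R y z\<close> by (auto simp: translate_def)
    then show ?thesis unfolding translate_def
      using \<open>w \<in> carrier Q\<close> by (intro conjI bexI[of _ "(w, u)"]) (auto simp: Q.idem)
  qed
  have left: "?E (x, w) (z, w)" if "equivclp (translate Q) x z" "w \<in> carrier R" for x z w
    using that
  proof (induction rule: equivclp_induct)
    case (step y z)
    then show ?case using left_step by (metis equivclp_into_equivclp)
  qed simp
  have right: "?E (w, x) (w, z)" if "equivclp (translate R) x z" "w \<in> carrier Q" for x z w
    using that
  proof (induction rule: equivclp_induct)
    case (step y z)
    then show ?case using right_step by (metis equivclp_into_equivclp)
  qed simp
  have "?E (x, x') (z, z')"
    if "x \<in> carrier Q" "z \<in> carrier Q" "x' \<in> carrier R" "z' \<in> carrier R" for x z x' z'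
    using left[of x z x'] right[of x' z' z] that assms(3,4) Q.connected_quandle_iff R.connected_quandle_iff
    by (metis equivclp_trans)
  then show ?thesis by (auto simp: P.connected_quandle_iff)
qed

lemma Good_quandle_prod:
  assumes "quandle Q" "quandle R" "\<rho> \<in> Good Q" "\<sigma> \<in> Good R"
  shows "restrict (map_prod \<rho> \<sigma>) (carrier Q \<times> carrier R) \<in> Good (quandle_prod Q R)"
proof -
  interpret Q: quandle Q by fact
  interpret R: quandle R by fact
  interpret P: quandle "quandle_prod Q R" using assms(1,2) by (rule quandle_quandle_prod)
  have "\<rho> x \<in> carrier Q" if "x \<in> carrier Q" for x using that assms(3) by (auto simp: Good_def)
  moreover have "\<sigma> x \<in> carrier R" if "x \<in> carrier R" for x using that assms(4) by (auto simp: Good_def)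
  ultimately show ?thesis
    using assms(3,4) by (auto simp: P.Good_iff Q.Good_iff R.Good_iff Q.closed R.closed)
qed

section \<open>Conjugation quandles\<close>

lemma carrier_Conj [simp]: "carrier (Conj G C) = C"
  by (simp add: Conj_def)

lemma qop_Conj [simp]: "x \<triangleleft>\<^bsub>Conj G C\<^esub> y = inv\<^bsub>G\<^esub> y \<otimes>\<^bsub>G\<^esub> x \<otimes>\<^bsub>G\<^esub> y"
  by (simp add: Conj_def)

lemma (in group) conjugacy_class_subset:
  "a \<in> carrier G \<Longrightarrow> conjugacy_class G a \<subseteq> carrier G"
  by (auto simp: conjugacy_class_def)

lemma (in group) conjugacy_class_self:
  "a \<in> carrier G \<Longrightarrow> a \<in> conjugacy_class G a"
  unfolding conjugacy_class_def by (auto intro!: exI[of _ \<one>])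

lemma (in group) conjugacy_class_closed:
  assumes "a \<in> carrier G" "x \<in> conjugacy_class G a" "g \<in> carrier G"
  shows "inv g \<otimes> x \<otimes> g \<in> conjugacy_class G a"
proof -
  obtain h where h: "h \<in> carrier G" "x = inv h \<otimes> a \<otimes> h"
    using assms(2) by (auto simp: conjugacy_class_def)
  then have "inv g \<otimes> x \<otimes> g = inv (h \<otimes> g) \<otimes> a \<otimes> (h \<otimes> g)"
    using assms by (simp add: inv_mult_group m_assoc)
  then show ?thesis using h assms unfolding conjugacy_class_def by blast
qed

lemma (in group) mult_inv_cancel:
  assumes "x \<in> carrier G" "y \<in> carrier G"
  shows "x \<otimes> (inv x \<otimes> y) = y" "inv x \<otimes> (x \<otimes> y) = y"
  using assms by (simp_all flip: m_assoc)

lemma (in group) quandle_Conj: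
  assumes C: "C \<subseteq> carrier G" "\<And>x g. x \<in> C \<Longrightarrow> g \<in> carrier G \<Longrightarrow> inv g \<otimes> x \<otimes> g \<in> C"
  shows "quandle (Conj G C)"
proof
  fix y assume "y \<in> carrier (Conj G C)"
  then have y: "y \<in> carrier G" using C by auto
  show "bij_betw (\<lambda>x. x \<triangleleft>\<^bsub>Conj G C\<^esub> y) (carrier (Conj G C)) (carrier (Conj G C))"
  proof (rule bij_betw_byWitness[where f' = "\<lambda>x. y \<otimes> x \<otimes> inv y"])
    show "(\<lambda>x. y \<otimes> x \<otimes> inv y) ` carrier (Conj G C) \<subseteq> carrier (Conj G C)"
      using C(2)[of _ "inv y"] y by auto
  qed (use C y in \<open>auto simp: m_assoc subset_iff mult_inv_cancel\<close>)
next
  fix x y z assume "x \<in> carrier (Conj G C)" "y \<in> carrier (Conj G C)" "z \<in> carrier (Conj G C)"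
  then have "x \<in> carrier G" "y \<in> carrier G" "z \<in> carrier G" using C(1) by auto
  then show "x \<triangleleft>\<^bsub>Conj G C\<^esub> y \<triangleleft>\<^bsub>Conj G C\<^esub> z
      = x \<triangleleft>\<^bsub>Conj G C\<^esub> z \<triangleleft>\<^bsub>Conj G C\<^esub> (y \<triangleleft>\<^bsub>Conj G C\<^esub> z)"
    by (simp add: m_assoc inv_mult_group mult_inv_cancel)
next
  fix x assume "x \<in> carrier (Conj G C)"
  then have "x \<in> carrier G" using C(1) by auto
  then show "x \<triangleleft>\<^bsub>Conj G C\<^esub> x = x" by (simp add: m_assoc mult_inv_cancel)
qed (use C in auto)

lemma (in group) quandle_Conj_conjugacy_class:
  assumes "a \<in> carrier G"
  shows "quandle (Conj G (conjugacy_class G a))"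
  using assms by (intro quandle_Conj conjugacy_class_subset conjugacy_class_closed)

text \<open>A word in the class acts by successive conjugation with its letters, so a chain of
  translations realises conjugation by every element of the generated subgroup. If that
  subgroup is the whole group, \<open>a\<close> reaches all its conjugates.\<close>

lemma (in group) connected_quandle_Conj:
  assumes a: "a \<in> carrier G" and gen: "carrier G \<subseteq> generate G (conjugacy_class G a)"
  shows "connected_quandle (Conj G (conjugacy_class G a))"
proof -
  let ?C = "conjugacy_class G a"
  let ?E = "equivclp (translate (Conj G ?C))"
  interpret quandle "Conj G ?C" using a by (rule quandle_Conj_conjugacy_class)
  have sub: "x \<in> carrier G" if "x \<in> ?C" for x using conjugacy_class_subset[OF a] that by blast
  have step: "?E x (inv h \<otimes> x \<otimes> h)" if "x \<in> ?C" "h \<in> ?C" for x h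
    using that by (auto simp: translate_def intro!: r_into_equivclp)
  have reach: "\<forall>x\<in>?C. ?E x (inv g \<otimes> x \<otimes> g)" if "g \<in> generate G ?C" for g
    using that
  proof induction
    case one
    then show ?case by (simp add: sub)
  next
    case (incl h)
    then show ?case using step by blast
  next
    case (inv h)
    show ?case
    proof
      fix x assume x: "x \<in> ?C"
      let ?z = "inv (inv h) \<otimes> x \<otimes> inv h"
      have "?z \<in> ?C" using conjugacy_class_closed[OF a x, of "inv h"] inv sub by simp
      moreover have "inv h \<otimes> ?z \<otimes> h = x"
        using x inv by (simp add: sub m_assoc mult_inv_cancel)
      ultimately show "?E x ?z" using step[of ?z h] inv by (metis equivclp_sym)
    qed
  next
    case (eng g h)
    then have gh: "g \<in> carrier G" "h \<in> carrier G"
      using generate_in_carrier[of ?C] sub by blast+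
    show ?case
    proof
      fix x assume x: "x \<in> ?C"
      have "inv g \<otimes> x \<otimes> g \<in> ?C" using conjugacy_class_closed[OF a x gh(1)] .
      then have "?E (inv g \<otimes> x \<otimes> g) (inv h \<otimes> (inv g \<otimes> x \<otimes> g) \<otimes> h)" using eng.IH(2) by blast
      moreover have "inv h \<otimes> (inv g \<otimes> x \<otimes> g) \<otimes> h = inv (g \<otimes> h) \<otimes> x \<otimes> (g \<otimes> h)"
        using gh sub[OF x] by (simp add: m_assoc inv_mult_group)
      ultimately show "?E x (inv (g \<otimes> h) \<otimes> x \<otimes> (g \<otimes> h))"
        using eng.IH(1) x by (metis equivclp_trans)
    qed
  qed
  have "?E a x" if "x \<in> ?C" for x
    using that reach gen conjugacy_class_self[OF a] by (auto simp: conjugacy_class_def)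
  then show ?thesis unfolding connected_quandle_iff carrier_Conj
    by (metis equivclp_sym equivclp_trans)
qed

text \<open>Inversion turns conjugation by \<open>y\<close> into conjugation by its inverse, which is what a good
  involution must do; a central factor \<open>z\<close> changes neither this nor the compatibility with
  conjugation. On a nonempty set, distinct central elements give distinct maps.\<close>

lemma (in group) central_inverse_Good:
  assumes C: "C \<subseteq> carrier G" "\<And>x g. x \<in> C \<Longrightarrow> g \<in> carrier G \<Longrightarrow> inv g \<otimes> x \<otimes> g \<in> C"
    and z: "z \<in> carrier G" "\<And>g. g \<in> carrier G \<Longrightarrow> z \<otimes> g = g \<otimes> z"
    and zC: "\<And>x. x \<in> C \<Longrightarrow> z \<otimes> inv x \<in> C"
  shows "(\<lambda>x\<in>C. z \<otimes> inv x) \<in> Good (Conj G C)"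
proof -
  interpret quandle "Conj G C" using C by (rule quandle_Conj)
  have sub: "x \<in> carrier G" if "x \<in> C" for x using C(1) that by blast
  have conj: "inv y \<otimes> x \<otimes> y \<in> C" if "x \<in> C" "y \<in> C" for x y using that C(2) sub by blast
  have inv2: "z \<otimes> inv (z \<otimes> inv x) = x" if "x \<in> carrier G" for x
  proof -
    have "z \<otimes> inv (z \<otimes> inv x) = z \<otimes> (x \<otimes> inv z)" using that z(1) by (simp add: inv_mult_group)
    also have "\<dots> = (z \<otimes> x) \<otimes> inv z" using that z(1) by (simp add: m_assoc)
    also have "\<dots> = x" using that z(1) unfolding z(2)[OF that] by (simp add: m_assoc)
    finally show ?thesis .
  qed
  have eqv: "z \<otimes> inv (inv y \<otimes> x \<otimes> y) = inv y \<otimes> (z \<otimes> inv x) \<otimes> y"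
    if "x \<in> carrier G" "y \<in> carrier G" for x y
  proof -
    have "z \<otimes> inv (inv y \<otimes> x \<otimes> y) = (z \<otimes> inv y) \<otimes> (inv x \<otimes> y)"
      using that z(1) by (simp add: inv_mult_group m_assoc)
    also have "\<dots> = inv y \<otimes> (z \<otimes> inv x) \<otimes> y"
      using that z(1) unfolding z(2)[OF inv_closed[OF that(2)]] by (simp add: m_assoc)
    finally show ?thesis .
  qed
  have cancel: "inv y \<otimes> (inv (z \<otimes> inv y) \<otimes> x \<otimes> (z \<otimes> inv y)) \<otimes> y = x"
    if "x \<in> carrier G" "y \<in> carrier G" for x y
  proof -
    have "inv y \<otimes> (inv (z \<otimes> inv y) \<otimes> x \<otimes> (z \<otimes> inv y)) \<otimes> y = inv z \<otimes> (x \<otimes> z)"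
      using that z(1) by (simp add: inv_mult_group m_assoc mult_inv_cancel)
    also have "\<dots> = x" using that z(1) unfolding z(2)[OF that(1), symmetric] by (simp add: mult_inv_cancel)
    finally show ?thesis .
  qed
  show ?thesis
    using zC by (auto simp: Good_iff conj inv2 eqv cancel sub)
qed

section \<open>The class of J in GL(2,3)\<close>

lemma mat2_eq_iff: "A = B \<longleftrightarrow> A$1$1 = B$1$1 \<and> A$1$2 = B$1$2 \<and> A$2$1 = B$2$1 \<and> A$2$2 = B$2$2"
  for A B :: "'a^2^2"
  by (auto simp: vec_eq_iff forall_2)

lemma mat2_mult_nth [simp]: "(A ** B)$i$j = A$i$1 * B$1$j + A$i$2 * B$2$j"
  for A B :: "'a::semiring_1^2^2"
  by (simp add: matrix_matrix_mult_def sum_2)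

lemma mat2_mat_nth [simp]:
  "(mat k :: 'a::zero^2^2)$1$1 = k" "(mat k :: 'a^2^2)$1$2 = 0"
  "(mat k :: 'a^2^2)$2$1 = 0" "(mat k :: 'a^2^2)$2$2 = k"
  by (simp_all add: mat_def)

lemma trace_2: "trace A = A$1$1 + A$2$2" for A :: "'a::semiring_1^2^2"
  by (simp add: trace_def sum_2)

definition mat2 :: "'a \<Rightarrow> 'a \<Rightarrow> 'a \<Rightarrow> 'a \<Rightarrow> 'a::zero^2^2"
  where "mat2 p q r s = vector [vector [p, q], vector [r, s]]"

lemma mat2_nth [simp]:
  "(mat2 p q r s)$1$1 = p" "(mat2 p q r s)$1$2 = q" "(mat2 p q r s)$2$1 = r" "(mat2 p q r s)$2$2 = s"
  by (simp_all add: mat2_def)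

lemma J_mat2: "J = mat2 0 1 1 0"
  by (simp add: J_def mat2_def)

text \<open>A nonzero element of \<open>3\<close> is its own inverse, so the inverse matrix is the adjugate
  times the determinant.\<close>

lemma invertible_iff_det_nz: "invertible A \<longleftrightarrow> det A \<noteq> 0" for A :: "3^2^2"
proof
  assume "invertible A"
  then obtain B where "A ** B = mat 1" by (auto simp: invertible_def)
  then have "det A * det B = 1" by (metis det_I det_mul)
  then show "det A \<noteq> 0" by auto
next
  let ?d = "det A"
  let ?B = "mat2 (?d * A$2$2) (- ?d * A$1$2) (- ?d * A$2$1) (?d * A$1$1)"
  assume "?d \<noteq> 0"
  then have "?d * ?d = 1" by (rule F3_inverse)
  then have "?d * (A$1$1 * A$2$2 - A$1$2 * A$2$1) = 1" by (simp only: det_2)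
  then have "A ** ?B = mat 1" "?B ** A = mat 1"
    by (simp_all add: mat2_eq_iff algebra_simps)
  then show "invertible A" by (auto simp: invertible_def)
qed

lemma carrier_GL2_F3: "A \<in> carrier GL2_F3 \<longleftrightarrow> det A \<noteq> 0"
  by (simp add: GL2_F3_def invertible_iff_det_nz)

lemma mult_GL2_F3 [simp]: "A \<otimes>\<^bsub>GL2_F3\<^esub> B = A ** B"
  by (simp add: GL2_F3_def)

lemma one_GL2_F3 [simp]: "\<one>\<^bsub>GL2_F3\<^esub> = mat 1"
  by (simp add: GL2_F3_def)

lemma F3_cases:
  fixes x :: 3
  obtains "x = 0" | "x = 1" | "x = -1"
  using exhaust_3[of x] by auto

lemma F3_nz_iff: "x \<noteq> 0 \<longleftrightarrow> x = 1 \<or> x = -1" for x :: 3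
  by (cases x rule: F3_cases) auto

text \<open>A matrix of trace 0 and determinant -1 squares to the identity (Cayley-Hamilton), so it
  swaps \<open>v\<close> and \<open>A v\<close> for every vector \<open>v\<close>. If these two vectors form a basis, then \<open>A\<close> is
  conjugate to \<open>J\<close> by the matrix \<open>P\<close> with columns \<open>v\<close> and \<open>A v\<close>. The three cases below
  take for \<open>v\<close> the first basis vector, the second one, and, for diagonal \<open>A\<close>, their sum.\<close>

lemma conjugacy_class_J: "conjugacy_class GL2_F3 J = {A. trace A = 0 \<and> det A = -1}"
proof (intro equalityI subsetI CollectI)
  interpret G: group GL2_F3 by (rule group_GL2_F3)
  fix A assume "A \<in> conjugacy_class GL2_F3 J"
  then obtain g where g: "g \<in> carrier GL2_F3" "A = (inv\<^bsub>GL2_F3\<^esub> g ** J) ** g"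
    by (auto simp: conjugacy_class_def)
  let ?h = "inv\<^bsub>GL2_F3\<^esub> g"
  have gh: "g ** ?h = mat 1" using G.r_inv[OF g(1)] by simp
  have "trace A = trace (g ** (?h ** J))" unfolding g(2) by (rule trace_mul_sym)
  also have "\<dots> = trace J" by (simp only: matrix_mul_assoc gh matrix_mul_lid)
  finally have "trace A = 0" by (simp add: trace_2 J_mat2)
  moreover have "det A = det J * (det g * det ?h)" by (simp add: g(2) det_mul)
  then have "det A = -1" unfolding det_mul[symmetric] gh by (simp add: det_2 J_mat2)
  ultimately show "trace A = 0 \<and> det A = -1" ..
next
  interpret G: group GL2_F3 by (rule group_GL2_F3)
  fix A :: "3^2^2" assume "A \<in> {A. trace A = 0 \<and> det A = -1}"
  then have tr: "A$2$2 = - A$1$1" and dt: "A$1$1 * A$2$2 - A$1$2 * A$2$1 = -1"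
    by (simp_all add: trace_2 det_2 eq_neg_iff_add_eq_0 add.commute)
  have "\<exists>P. det P \<noteq> 0 \<and> A ** P = P ** J"
  proof -
    consider "A$2$1 \<noteq> 0" | "A$1$2 \<noteq> 0" | "A$2$1 = 0" "A$1$2 = 0" by blast
    then show ?thesis
    proof cases
      case 1
      then show ?thesis using tr dt
        by (intro exI[of _ "mat2 1 (A$1$1) 0 (A$2$1)"])
          (auto simp: det_2 mat2_eq_iff J_mat2 algebra_simps)
    next
      case 2
      then show ?thesis using tr dt
        by (intro exI[of _ "mat2 0 (A$1$2) 1 (A$2$2)"])
          (auto simp: det_2 mat2_eq_iff J_mat2 algebra_simps)
    next
      case 3
      then have "A$1$1 \<noteq> 0" "A$1$1 * A$1$1 = 1" using tr dt by auto
      then show ?thesis using tr 3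
        by (intro exI[of _ "mat2 1 (A$1$1) 1 (A$2$2)"])
          (auto simp: det_2 mat2_eq_iff J_mat2 F3_nz_iff)
    qed
  qed
  then obtain P where P: "P \<in> carrier GL2_F3" "A ** P = P ** J" by (auto simp: carrier_GL2_F3)
  let ?g = "inv\<^bsub>GL2_F3\<^esub> P"
  have g: "?g \<in> carrier GL2_F3" using P(1) by simp
  have "A = (A ** P) ** ?g"
    using G.r_inv[OF P(1)] by (simp add: matrix_mul_assoc[symmetric])
  also have "\<dots> = (inv\<^bsub>GL2_F3\<^esub> ?g ** J) ** ?g" using P by simp
  finally show "A \<in> conjugacy_class GL2_F3 J"
    using g by (auto simp: conjugacy_class_def)
qed

lemma class_J_square:
  assumes "z \<in> conjugacy_class GL2_F3 J"
  shows "z ** z = mat 1"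
proof -
  have "z$2$2 = - z$1$1" "z$1$1 * z$2$2 - z$1$2 * z$2$1 = -1"
    using assms by (simp_all add: conjugacy_class_J trace_2 det_2 eq_neg_iff_add_eq_0 add.commute)
  then show ?thesis by (auto simp: mat2_eq_iff algebra_simps)
qed

text \<open>Every \<open>A\<close> of determinant 1 is a product of two elements of the class: it suffices to find
  \<open>z\<close> in the class with \<open>trace (A ** z) = 0\<close>, because then \<open>A ** z\<close> has determinant -1, hence
  lies in the class, and \<open>z\<close> is its own inverse. For \<open>z\<close> with rows \<open>(a, b)\<close> and \<open>(c, -a)\<close>
  the trace condition is linear in \<open>a, b, c\<close>. For \<open>A\<close> of determinant -1 apply this to
  \<open>A ** J\<close>.\<close>

lemma GL2_F3_generated_by_class_J:
  "carrier GL2_F3 \<subseteq> generate GL2_F3 (conjugacy_class GL2_F3 J)"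
proof
  let ?C = "conjugacy_class GL2_F3 J"
  have gen2: "x ** y \<in> generate GL2_F3 ?C"
    if "x \<in> generate GL2_F3 ?C" "y \<in> ?C" for x y
    using generate.eng[OF that(1) generate.incl[OF that(2)]] by simp
  have SL: "A \<in> generate GL2_F3 ?C" if A: "det A = 1" for A
  proof -
    have "\<exists>z\<in>?C. trace (A ** z) = 0"
    proof -
      let ?u = "A$1$1 - A$2$2"
      consider "?u = 0" | "?u \<noteq> 0" "A$1$2 \<noteq> 0" | "?u \<noteq> 0" "A$2$1 \<noteq> 0"
        | "A$1$2 = 0" "A$2$1 = 0" by blast
      then show ?thesis
      proof cases
        case 1
        then show ?thesis
          by (intro bexI[of _ "mat2 1 0 0 (-1)"])
            (simp_all add: conjugacy_class_J trace_2 det_2)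
      next
        case 2
        then have "A$1$2 * (A$1$2 * ?u) = ?u" using F3_inverse[of "A$1$2"] by (simp flip: mult.assoc)
        then show ?thesis
          by (intro bexI[of _ "mat2 1 0 (- (A$1$2 * ?u)) (-1)"])
            (simp_all add: conjugacy_class_J trace_2 det_2 algebra_simps)
      next
        case 3
        then have "A$2$1 * (A$2$1 * ?u) = ?u" using F3_inverse[of "A$2$1"] by (simp flip: mult.assoc)
        then show ?thesis
          by (intro bexI[of _ "mat2 1 (- (A$2$1 * ?u)) 0 (-1)"])
            (simp_all add: conjugacy_class_J trace_2 det_2 algebra_simps)
      next
        case 4
        then show ?thesis
          by (intro bexI[of _ "mat2 0 1 1 0"])
            (simp_all add: conjugacy_class_J trace_2 det_2)
      qed
    qed
    then obtain z where z: "z \<in> ?C" "trace (A ** z) = 0" by blast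
    then have "A ** z \<in> ?C" using A by (simp add: conjugacy_class_J det_mul)
    then have "(A ** z) ** z \<in> generate GL2_F3 ?C" using z(1) by (intro gen2 generate.incl)
    then show ?thesis by (simp add: class_J_square[OF z(1)] flip: matrix_mul_assoc)
  qed
  fix A assume "A \<in> carrier GL2_F3"
  then consider "det A = 1" | "det A = -1" by (auto simp: carrier_GL2_F3 F3_nz_iff)
  then show "A \<in> generate GL2_F3 ?C"
  proof cases
    case 2
    have J: "J \<in> ?C" using group.conjugacy_class_self[OF group_GL2_F3 J_in_GL2_F3] .
    then have "det (A ** J) = 1" using 2 by (simp add: det_mul conjugacy_class_J)
    then have "(A ** J) ** J \<in> generate GL2_F3 ?C" using J by (intro gen2 SL)
    then show ?thesis by (simp add: class_J_square[OF J] flip: matrix_mul_assoc)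
  qed (rule SL)
qed

lemma inv_class_J:
  assumes "z \<in> conjugacy_class GL2_F3 J"
  shows "inv\<^bsub>GL2_F3\<^esub> z = z"
proof -
  interpret G: group GL2_F3 by (rule group_GL2_F3)
  have "z \<in> carrier GL2_F3" using assms G.conjugacy_class_subset[OF J_in_GL2_F3] by blast
  then show ?thesis using class_J_square[OF assms] by (intro G.inv_equality) simp_all
qed

lemma uminus_class_J: "z \<in> conjugacy_class GL2_F3 J \<Longrightarrow> - z \<in> conjugacy_class GL2_F3 J"
  by (simp add: conjugacy_class_J trace_2 det_2 neg_eq_iff_add_eq_0)

section \<open>Three-cycles\<close>

text \<open>In a conjugation quandle, translating twice by \<open>y\<close> fixes \<open>x\<close> exactly if \<open>x\<close> commutes
  with the square of \<open>y\<close>. The square of a 3-cycle is again a 3-cycle, and two 3-cycles whose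
  supports meet in a single point do not commute.\<close>

lemma three_cycles_noninvolutory:
  "\<exists>x\<in>three_cycles 5. \<exists>y\<in>three_cycles 5. x \<circ> (y \<circ> y) \<noteq> y \<circ> (y \<circ> x)"
proof (intro bexI)
  have "(cycle_of_list [1,2,3] \<circ> (cycle_of_list [3,4,5::nat] \<circ> cycle_of_list [3,4,5])) 2
    \<noteq> (cycle_of_list [3,4,5] \<circ> (cycle_of_list [3,4,5] \<circ> cycle_of_list [1,2,3])) 2"
    by (simp add: Transposition.transpose_def)
  then show "cycle_of_list [1,2,3] \<circ> (cycle_of_list [3,4,5::nat] \<circ> cycle_of_list [3,4,5])
    \<noteq> cycle_of_list [3,4,5] \<circ> (cycle_of_list [3,4,5] \<circ> cycle_of_list [1,2,3])"
    by metis
  show "cycle_of_list [3,4,5::nat] \<in> three_cycles 5"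
    by (intro CollectI exI[of _ "[3,4,5]"]) auto
  show "cycle_of_list [1,2,3::nat] \<in> three_cycles 5"
    by (intro CollectI exI[of _ "[1,2,3]"]) auto
qed

lemma inv_three_cycle:
  assumes "x \<in> three_cycles n"
  shows "inv\<^bsub>alt_group n\<^esub> x \<in> three_cycles n"
proof -
  obtain cs where cs: "x = cycle_of_list cs" "cycle cs" "length cs = 3" "set cs \<subseteq> {1..n}"
    using assms by auto
  obtain a b c where abc: "cs = [a, b, c]" using stupid_lemma[OF cs(3)] by blast
  have y: "cycle_of_list [c, b, a] \<in> three_cycles n"
    using cs by (intro CollectI exI[of _ "[c, b, a]"]) (auto simp: abc)
  have "cycle_of_list [c, b, a] \<circ> x = id"
    using cs(2) by (auto simp: cs(1) abc fun_eq_iff Transposition.transpose_def)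
  then have "inv\<^bsub>alt_group n\<^esub> x = cycle_of_list [c, b, a]"
    using assms y three_cycles_incl
    by (intro group.inv_equality[OF alt_group_is_group]) (auto simp: alt_group_mult alt_group_one)
  with y show ?thesis by simp
qed


section \<open>The product of the two conjugation quandles\<close>

theorem mainTheorem7:
  fixes X\<^sub>1 :: "(3^2^2) set" and X\<^sub>2 :: "(nat \<Rightarrow> nat) set" and c :: "nat \<Rightarrow> nat"
    and P :: "((3^2^2) \<times> (nat \<Rightarrow> nat)) quandle_struct"
  assumes "X\<^sub>1 = conjugacy_class GL2_F3 J"
    and "c \<in> three_cycles 5"
    and "X\<^sub>2 = conjugacy_class (alt_group 5) c"
    and "P = quandle_prod (Conj GL2_F3 X\<^sub>1) (Conj (alt_group 5) X\<^sub>2)"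
  shows "quandle P \<and> connected_quandle P \<and> \<not> involutory P \<and> card (Good P) \<ge> 2"
proof -
  interpret G: group GL2_F3 by (rule group_GL2_F3)
  interpret A: group "alt_group 5" by (rule alt_group_is_group)
  have X2: "X\<^sub>2 = three_cycles 5"
    using three_cycles_conjugacy_class[OF assms(2)] assms(3) by simp
  have c: "c \<in> carrier (alt_group 5)" using three_cycles_incl assms(2) by blast
  have sub1: "X\<^sub>1 \<subseteq> carrier GL2_F3"
    unfolding assms(1) by (rule G.conjugacy_class_subset[OF J_in_GL2_F3])
  have sub2: "X\<^sub>2 \<subseteq> carrier (alt_group 5)"
    unfolding assms(3) by (rule A.conjugacy_class_subset[OF c])
  have J: "J \<in> X\<^sub>1"
    unfolding assms(1) by (rule G.conjugacy_class_self[OF J_in_GL2_F3])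
  let ?Q = "Conj GL2_F3 X\<^sub>1" and ?R = "Conj (alt_group 5) X\<^sub>2"
  have Q: "quandle ?Q"
    unfolding assms(1) by (rule G.quandle_Conj_conjugacy_class[OF J_in_GL2_F3])
  have R: "quandle ?R"
    unfolding assms(3) by (rule A.quandle_Conj_conjugacy_class[OF c])
  interpret P: quandle P unfolding assms(4) using Q R by (rule quandle_quandle_prod)

  have "connected_quandle ?Q"
    unfolding assms(1)
    by (rule G.connected_quandle_Conj[OF J_in_GL2_F3 GL2_F3_generated_by_class_J])
  moreover have "connected_quandle ?R"
    unfolding assms(3)
    by (rule A.connected_quandle_Conj[OF c])
      (use alt_group_carrier_as_three_cycles[of 5] X2 assms(3) in simp)
  ultimately have conn: "connected_quandle P"
    unfolding assms(4) by (rule connected_quandle_prod[OF Q R])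

  have "\<not> involutory P"
  proof
    assume inv: "involutory P"
    obtain x y where xy: "x \<in> X\<^sub>2" "y \<in> X\<^sub>2" "x \<circ> (y \<circ> y) \<noteq> y \<circ> (y \<circ> x)"
      using three_cycles_noninvolutory X2 by blast
    then have xy': "x \<in> carrier (alt_group 5)" "y \<in> carrier (alt_group 5)" using sub2 by auto
    have mem: "(J, x) \<in> carrier P" "(J, y) \<in> carrier P"
      using J xy(1,2) by (simp_all add: assms(4))
    have "(J, x) \<triangleleft>\<^bsub>P\<^esub> (J, y) \<triangleleft>\<^bsub>P\<^esub> (J, y) = (J, x)"
      using inv mem unfolding P.involutory_iff by blast
    then have "x = inv\<^bsub>alt_group 5\<^esub> y \<otimes>\<^bsub>alt_group 5\<^esub> (inv\<^bsub>alt_group 5\<^esub> y \<otimes>\<^bsub>alt_group 5\<^esub> x \<otimes>\<^bsub>alt_group 5\<^esub> y) \<otimes>\<^bsub>alt_group 5\<^esub> y"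
      by (simp add: assms(4))
    then have "y \<otimes>\<^bsub>alt_group 5\<^esub> (y \<otimes>\<^bsub>alt_group 5\<^esub> x) = x \<otimes>\<^bsub>alt_group 5\<^esub> (y \<otimes>\<^bsub>alt_group 5\<^esub> y)"
      using xy' by (metis A.inv_solve_left A.inv_solve_left' A.m_assoc A.inv_closed A.m_closed)
    then show False using xy(3) by (simp add: alt_group_mult)
  qed

  moreover have "card (Good P) \<ge> 2"
  proof -
    have good1: "(\<lambda>x\<in>X\<^sub>1. z \<otimes>\<^bsub>GL2_F3\<^esub> inv\<^bsub>GL2_F3\<^esub> x) \<in> Good ?Q"
      if "z = mat 1 \<or> z = - mat 1" for z
    proof (rule G.central_inverse_Good[OF sub1])
      show "inv\<^bsub>GL2_F3\<^esub> g \<otimes>\<^bsub>GL2_F3\<^esub> x \<otimes>\<^bsub>GL2_F3\<^esub> g \<in> X\<^sub>1" if "x \<in> X\<^sub>1" "g \<in> carrier GL2_F3" for x g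
        using that G.conjugacy_class_closed[OF J_in_GL2_F3] unfolding assms(1) by blast
      show "z \<in> carrier GL2_F3"
        using that by (auto simp: carrier_GL2_F3 det_2)
      show "z \<otimes>\<^bsub>GL2_F3\<^esub> g = g \<otimes>\<^bsub>GL2_F3\<^esub> z" for g
        using that by (auto simp: mat2_eq_iff)
      fix x assume x: "x \<in> X\<^sub>1"
      have "z ** x = x \<or> z ** x = - x"
        using that by (auto simp: mat2_eq_iff)
      then show "z \<otimes>\<^bsub>GL2_F3\<^esub> inv\<^bsub>GL2_F3\<^esub> x \<in> X\<^sub>1"
        using x uminus_class_J inv_class_J unfolding assms(1) by auto
    qed
    have good2: "(\<lambda>x\<in>X\<^sub>2. \<one>\<^bsub>alt_group 5\<^esub> \<otimes>\<^bsub>alt_group 5\<^esub> inv\<^bsub>alt_group 5\<^esub> x) \<in> Good ?R"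
    proof (rule A.central_inverse_Good[OF sub2])
      show "inv\<^bsub>alt_group 5\<^esub> g \<otimes>\<^bsub>alt_group 5\<^esub> x \<otimes>\<^bsub>alt_group 5\<^esub> g \<in> X\<^sub>2"
        if "x \<in> X\<^sub>2" "g \<in> carrier (alt_group 5)" for x g
        using that A.conjugacy_class_closed[OF c] unfolding assms(3) by blast
      fix x assume x: "x \<in> X\<^sub>2"
      then have "inv\<^bsub>alt_group 5\<^esub> x \<in> X\<^sub>2" unfolding X2 by (rule inv_three_cycle)
      then show "\<one>\<^bsub>alt_group 5\<^esub> \<otimes>\<^bsub>alt_group 5\<^esub> inv\<^bsub>alt_group 5\<^esub> x \<in> X\<^sub>2"
        using x sub2 by (simp add: subset_iff)
    qed auto
    \<comment> \<open>On the first factor, whose elements are self-inverse, \<open>z\<close> gives the identity or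
      negation; on the second factor only inversion is used.\<close>
    define \<rho> where "\<rho> z = restrict (map_prod (\<lambda>x\<in>X\<^sub>1. z \<otimes>\<^bsub>GL2_F3\<^esub> inv\<^bsub>GL2_F3\<^esub> x)
      (\<lambda>x\<in>X\<^sub>2. \<one>\<^bsub>alt_group 5\<^esub> \<otimes>\<^bsub>alt_group 5\<^esub> inv\<^bsub>alt_group 5\<^esub> x)) (X\<^sub>1 \<times> X\<^sub>2)" for z
    have "\<rho> z \<in> Good P" if "z = mat 1 \<or> z = - mat 1" for z
      using Good_quandle_prod[OF Q R good1[OF that] good2] by (simp add: \<rho>_def assms(4))
    then have sub: "{\<rho> (mat 1), \<rho> (- mat 1)} \<subseteq> Good P" by blast
    have "c \<in> X\<^sub>2" using assms(2) X2 by simp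
    then have "fst (\<rho> (mat 1) (J, c)) = J" "fst (\<rho> (- mat 1) (J, c)) = - mat 1 ** J"
      using J inv_class_J unfolding assms(1) by (simp_all add: \<rho>_def assms(1))
    moreover have "- mat 1 ** J \<noteq> J"
      by (simp add: mat2_eq_iff J_mat2)
    ultimately have "\<rho> (mat 1) \<noteq> \<rho> (- mat 1)" by metis
    then have two: "card {\<rho> (mat 1), \<rho> (- mat 1)} = 2" by simp
    have "X\<^sub>2 \<subseteq> {p. p permutes {1..5}}" using sub2 alt_group_carrier by blast
    then have "finite X\<^sub>2" by (rule finite_subset) (simp add: finite_permutations)
    then have "finite (carrier P)" by (simp add: assms(4))
    then have "finite (carrier P \<rightarrow>\<^sub>E carrier P)" by (intro finite_PiE)
    moreover have "Good P \<subseteq> carrier P \<rightarrow>\<^sub>E carrier P" unfolding Good_def by blast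
    ultimately have "finite (Good P)" by (rule rev_finite_subset)
    then show ?thesis using card_mono[OF _ sub] two by simp
  qed
  ultimately show ?thesis using P.quandle_axioms conn by blast
qed

end
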